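(* For all $n\ge36$, let ${\mathcal X}$ be the family of edge sets of subgraphs of $K_n$ isomorphic to $K_4$ or to $K_{2,3}$, and let ${\mathcal U}$ be the matroid on $E(K_n)$ whose independent sets are the sets $F\subseteq E(K_n)$ with $|F|\le6$ and $F\notin{\mathcal X}$. Then the poset (under the weak order) of all partial elevations of ${\mathcal U}$ has two distinct maximal elements.
   Context: Weak order: ${\mathcal M}_1\preceq{\mathcal M}_2$ if every independent set of ${\mathcal M}_1$ is independent in ${\mathcal M}_2$. The truncation of a rank-$k$ matroid ${\mathcal M}_1$ is the rank-$(k-1)$ matroid whose independent sets are those of ${\mathcal M}_1$ of size at most $k-1$; ${\mathcal M}_1$ is an erection of ${\mathcal M}_0$ if ${\mathcal M}_0$ is the truncation of ${\mathcal M}_1$ (${\mathcal M}_0$ counts as a trivial erection of itself). A partial elevation of ${\mathcal M}_0$ is any matroid obtained from ${\mathcal M}_0$ by a sequence of erections. *)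

theory Defs
  imports Main
begin

text \<open>Simple graphs: edges are two-element sets of vertices.\<close>

record 'v graph =
  verts :: "'v set"
  edges :: "'v set set"

definition complete_graph :: "'v set \<Rightarrow> 'v graph" where
  "complete_graph V = \<lparr>verts = V, edges = {{u, v} | u v. u \<in> V \<and> v \<in> V \<and> u \<noteq> v}\<rparr>"

definition complete_bipartite_graph :: "'v set \<Rightarrow> 'v set \<Rightarrow> 'v graph" where
  "complete_bipartite_graph A B = \<lparr>verts = A \<union> B, edges = {{a, b} | a b. a \<in> A \<and> b \<in> B}\<rparr>"

text \<open>The first conjunct makes \<open>H\<close> itself a graph: its edges join vertices of \<open>H\<close>.\<close>

definition subgraph :: "'v graph \<Rightarrow> 'v graph \<Rightarrow> bool" where
  "subgraph H G \<longleftrightarrow>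
     (\<forall>e \<in> edges H. e \<subseteq> verts H) \<and> verts H \<subseteq> verts G \<and> edges H \<subseteq> edges G"

definition graph_isomorphic :: "'v graph \<Rightarrow> 'w graph \<Rightarrow> bool" where
  "graph_isomorphic G H \<longleftrightarrow>
     (\<exists>f. bij_betw f (verts G) (verts H) \<and>
          (\<forall>u \<in> verts G. \<forall>v \<in> verts G. {u, v} \<in> edges G \<longleftrightarrow> {f u, f v} \<in> edges H))"

abbreviation K :: "nat \<Rightarrow> nat graph" where
  "K n \<equiv> complete_graph {..<n}"

abbreviation K23 :: "nat graph" where
  "K23 \<equiv> complete_bipartite_graph {..<2} {2..<5}"

record 'a set_system =
  ground :: "'a set"
  indep :: "'a set set"

definition matroid :: "'a set_system \<Rightarrow> bool" where
  "matroid M \<longleftrightarrow>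
     finite (ground M) \<and>
     (\<forall>I \<in> indep M. I \<subseteq> ground M) \<and>
     {} \<in> indep M \<and>
     (\<forall>I \<in> indep M. \<forall>J. J \<subseteq> I \<longrightarrow> J \<in> indep M) \<and>
     (\<forall>I \<in> indep M. \<forall>J \<in> indep M. card J < card I \<longrightarrow>
        (\<exists>x \<in> I - J. insert x J \<in> indep M))"

definition rank :: "'a set_system \<Rightarrow> nat" where
  "rank M = Max (card ` indep M)"

definition weak_le :: "'a set_system \<Rightarrow> 'a set_system \<Rightarrow> bool" where
  "weak_le M N \<longleftrightarrow> ground M = ground N \<and> indep M \<subseteq> indep N"

text \<open>In rank 0 the truncated subtraction makes the truncation the matroid itself, which only
  reproduces a trivial erection.\<close>

definition truncation :: "'a set_system \<Rightarrow> 'a set_system" where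
  "truncation M = \<lparr>ground = ground M, indep = {I \<in> indep M. card I \<le> rank M - 1}\<rparr>"

definition erection :: "'a set_system \<Rightarrow> 'a set_system \<Rightarrow> bool" where
  "erection N M \<longleftrightarrow> matroid M \<and> matroid N \<and> (M = truncation N \<or> N = M)"

definition partial_elevations :: "'a set_system \<Rightarrow> 'a set_system set" where
  "partial_elevations M = {N. (\<lambda>A B. erection B A)\<^sup>*\<^sup>* M N}"

definition maximal_element :: "('a \<Rightarrow> 'a \<Rightarrow> bool) \<Rightarrow> 'a set \<Rightarrow> 'a \<Rightarrow> bool" where
  "maximal_element le P m \<longleftrightarrow> m \<in> P \<and> (\<forall>x \<in> P. le m x \<longrightarrow> x = m)"

definition X_family :: "nat \<Rightarrow> nat set set set" where
  "X_family n = {edges H | H. subgraph H (K n) \<and>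
                              (graph_isomorphic H (K 4) \<or> graph_isomorphic H K23)}"

definition U_matroid :: "nat \<Rightarrow> nat set set_system" where
  "U_matroid n = \<lparr>ground = edges (K n),
                  indep = {F. F \<subseteq> edges (K n) \<and> card F \<le> 6 \<and> F \<notin> X_family n}\<rparr>"

end

theory Submission
  imports Defs Complex_Main "HOL-Library.Function_Algebras"
begin

text \<open>
  Let \<open>L\<close> be the free elementary lift of the even cycle matroid of \<open>K\<^sub>n\<close>. A set of at most six edges
  is dependent in \<open>L\<close> iff it contains two distinct 4-cycles, that is, iff it is a \<open>K\<^sub>4\<close> or a
  \<open>K\<^sub>2\<^sub>,\<^sub>3\<close>; so \<open>\<U>\<close> is the truncation of \<open>L\<close> to rank 6. In the truncation of \<open>L\<close> to rank 8, the
  union \<open>D\<close> of two disjoint 4-cycles is a circuit-hyperplane; relaxing it gives a matroid \<open>R\<close> in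
  which \<open>D\<close> is independent and which is again a partial elevation of \<open>\<U>\<close>.

  No partial elevation \<open>N\<close> lies above both \<open>L\<close> and \<open>R\<close>. As every \<open>K\<^sub>2\<^sub>,\<^sub>3\<close> is a circuit of \<open>N\<close>, every
  \<open>K\<^sub>4\<^sub>,\<^sub>4\<close> has rank at most 8. There are two copies of \<open>K\<^sub>4\<^sub>,\<^sub>4\<close> on the vertices of \<open>D\<close> that contain
  \<open>D\<close>. If \<open>D\<close> is independent it spans both, so their union \<open>K\<^sub>2\<^sub>,\<^sub>2\<^sub>,\<^sub>2\<^sub>,\<^sub>2\<close> has rank 8 in \<open>N\<close>, although
  its rank in \<open>L\<close> is 9. Since the poset is finite, maximal elements above \<open>L\<close> and \<open>R\<close> differ.
\<close>

section \<open>Operations on matroids and basic facts\<close>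

definition truncate_to :: "nat \<Rightarrow> 'a set_system \<Rightarrow> 'a set_system" where
  "truncate_to k M = \<lparr>ground = ground M, indep = {I \<in> indep M. card I \<le> k}\<rparr>"

text \<open>Every set of nullity at most one becomes independent (the free elementary lift).\<close>

definition free_lift :: "'a set_system \<Rightarrow> 'a set_system" where
  "free_lift M = \<lparr>ground = ground M, indep = {I. I \<subseteq> ground M \<and> (\<exists>e. I - {e} \<in> indep M)}\<rparr>"

text \<open>Meant for a circuit-hyperplane \<open>D\<close>; the conditions on \<open>D\<close> are
  left to \<open>matroid_relaxation\<close>.\<close>

definition relaxation :: "'a set_system \<Rightarrow> 'a set \<Rightarrow> 'a set_system" where
  "relaxation M D = \<lparr>ground = ground M, indep = insert D (indep M)\<rparr>"

text \<open>Bounds the rank of a set of elements without a rank function on subsets. The set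
  \<open>A\<close> may stick out of the ground set.\<close>

definition rank_le :: "'a set_system \<Rightarrow> 'a set \<Rightarrow> nat \<Rightarrow> bool" where
  "rank_le M A k \<longleftrightarrow> (\<forall>I \<in> indep M. I \<subseteq> A \<longrightarrow> card I \<le> k)"

lemma matroidD:
  assumes "matroid M"
  shows matroid_finite_ground: "finite (ground M)"
    and matroid_indep_subset: "I \<in> indep M \<Longrightarrow> I \<subseteq> ground M"
    and matroid_empty: "{} \<in> indep M"
    and matroid_hereditary: "I \<in> indep M \<Longrightarrow> J \<subseteq> I \<Longrightarrow> J \<in> indep M"
    and matroid_augment: "I \<in> indep M \<Longrightarrow> J \<in> indep M \<Longrightarrow> card J < card I
      \<Longrightarrow> \<exists>x \<in> I - J. insert x J \<in> indep M"
  using assms unfolding matroid_def by blast+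

lemma matroidI:
  assumes "finite (ground M)" "\<And>I. I \<in> indep M \<Longrightarrow> I \<subseteq> ground M" "{} \<in> indep M"
    and "\<And>I J. I \<in> indep M \<Longrightarrow> J \<subseteq> I \<Longrightarrow> J \<in> indep M"
    and "\<And>I J. I \<in> indep M \<Longrightarrow> J \<in> indep M \<Longrightarrow> card J < card I
      \<Longrightarrow> \<exists>x \<in> I - J. insert x J \<in> indep M"
  shows "matroid M"
  using assms unfolding matroid_def by blast

lemma matroid_finite_indep: "matroid M \<Longrightarrow> I \<in> indep M \<Longrightarrow> finite I"
  by (meson finite_subset matroid_finite_ground matroid_indep_subset)

lemma finite_indep: "matroid M \<Longrightarrow> finite (indep M)"
  by (rule finite_subset[of _ "Pow (ground M)"])
    (auto dest: matroid_indep_subset simp: matroid_finite_ground)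

lemma card_le_rank: "matroid M \<Longrightarrow> I \<in> indep M \<Longrightarrow> card I \<le> rank M"
  unfolding rank_def by (simp add: finite_indep)

lemma rank_attained:
  assumes "matroid M"
  obtains B where "B \<in> indep M" "card B = rank M"
proof -
  have "rank M \<in> card ` indep M"
    unfolding rank_def using assms by (intro Max_in) (auto simp: finite_indep dest: matroid_empty)
  then show ?thesis using that by auto
qed

section \<open>Truncations and partial elevations\<close>

lemma matroid_truncate:
  assumes "matroid M"
  shows "matroid (truncate_to k M)"
proof (rule matroidI)
  fix I J
  assume I: "I \<in> indep (truncate_to k M)"
  show "J \<in> indep (truncate_to k M)" if "J \<subseteq> I"
    using I that matroid_hereditary[OF assms, of I J] card_mono[of I J]
      matroid_finite_indep[OF assms, of I]
    by (auto simp: truncate_to_def)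
  assume J: "J \<in> indep (truncate_to k M)" and less: "card J < card I"
  obtain x where "x \<in> I - J" "insert x J \<in> indep M"
    using matroid_augment[OF assms, of I J] I J less by (auto simp: truncate_to_def)
  moreover have "card (insert x J) \<le> k"
    using I less card_insert_le_m1[of k J x] by (cases "k = 0") (auto simp: truncate_to_def)
  ultimately show "\<exists>x \<in> I - J. insert x J \<in> indep (truncate_to k M)"
    by (auto simp: truncate_to_def)
qed (use matroidD[OF assms] in \<open>auto simp: truncate_to_def\<close>)

lemma truncation_eq_truncate: "truncation M = truncate_to (rank M - 1) M"
  by (simp add: truncation_def truncate_to_def)

lemma truncate_truncate: "truncate_to k (truncate_to m M) = truncate_to (min k m) M"
  by (auto simp: truncate_to_def)

lemma truncate_ge_rank: "matroid M \<Longrightarrow> rank M \<le> k \<Longrightarrow> truncate_to k M = M"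
  using card_le_rank[of M] by (cases M) (force simp: truncate_to_def)

lemma rank_truncate:
  assumes "matroid M" "k \<le> rank M"
  shows "rank (truncate_to k M) = k"
proof (rule antisym)
  obtain B where "B \<in> indep (truncate_to k M)" "card B = rank (truncate_to k M)"
    using rank_attained[OF matroid_truncate[OF assms(1)]] by blast
  then show "rank (truncate_to k M) \<le> k" by (auto simp: truncate_to_def)
  obtain C where C: "C \<in> indep M" "card C = rank M" using rank_attained[OF assms(1)] .
  then obtain C' where "C' \<subseteq> C" "card C' = k"
    using assms(2) obtain_subset_with_card_n by metis
  with C have "C' \<in> indep (truncate_to k M)"
    using matroid_hereditary[OF assms(1)] by (auto simp: truncate_to_def)
  then show "k \<le> rank (truncate_to k M)"
    using card_le_rank[OF matroid_truncate[OF assms(1)]] \<open>card C' = k\<close> by metis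
qed

text \<open>Up to the rank of \<open>M\<close> each level is the truncation of the next one; beyond
  it both levels equal \<open>M\<close> and the erection is trivial.\<close>

lemma erection_truncate:
  assumes "matroid M"
  shows "erection (truncate_to (Suc k) M) (truncate_to k M)"
proof (cases "Suc k \<le> rank M")
  case True
  then have "truncation (truncate_to (Suc k) M) = truncate_to k M"
    using assms by (simp add: truncation_eq_truncate truncate_truncate rank_truncate)
  then show ?thesis using assms by (simp add: erection_def matroid_truncate)
next
  case False
  then show ?thesis using assms by (simp add: erection_def truncate_ge_rank)
qed

lemma truncate_mem_partial_elevations:
  assumes "matroid M"
  shows "truncate_to (k + m) M \<in> partial_elevations (truncate_to k M)"
proof (induction m)
  case (Suc m)
  then show ?case
    using erection_truncate[OF assms, of "k + m"]
    by (auto simp: partial_elevations_def intro: rtranclp.rtrancl_into_rtrancl)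
qed (simp add: partial_elevations_def)

text \<open>The truncations at \<open>k\<close>, \<open>k + 1\<close>, ... are successive erections,
  and at \<open>k + rank M\<close> nothing is cut off any more.\<close>

lemma mem_partial_elevations_truncate:
  assumes "matroid M"
  shows "M \<in> partial_elevations (truncate_to k M)"
  using truncate_mem_partial_elevations[OF assms, of k "rank M"] assms
  by (simp add: truncate_ge_rank)

text \<open>A nontrivial erection only adds independent sets larger than the rank of the matroid
  that it extends, and along the chain this rank never falls below \<open>rank U\<close>.\<close>

lemma partial_elevations_truncate:
  assumes "matroid U" "N \<in> partial_elevations U"
  shows "matroid N \<and> truncate_to (rank U) N = U"
  using assms(2) unfolding partial_elevations_def mem_Collect_eq
proof (induction rule: rtranclp_induct)
  case base
  then show ?case using assms(1) by (simp add: truncate_ge_rank)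
next
  case (step A B)
  then have B: "matroid B" and AB: "A = truncate_to (rank B - 1) B \<or> B = A"
    by (auto simp: erection_def truncation_eq_truncate)
  show ?case
  proof (cases "B = A")
    case False
    with AB have A: "A = truncate_to (rank B - 1) B" by simp
    obtain C where C: "C \<in> indep U" "card C = rank U"
      using rank_attained[OF assms(1)] .
    have "C \<in> indep (truncate_to (rank U) A)" using C step.IH by simp
    then have "C \<in> indep A" by (simp add: truncate_to_def)
    \<comment> \<open>The base \<open>C\<close> of \<open>U\<close> survives in \<open>A\<close>, so
      the truncation of \<open>B\<close> to \<open>rank U\<close> passes through
      \<open>A\<close>.\<close>
    then have "rank U \<le> rank B - 1" using A C by (auto simp: truncate_to_def)
    then have "truncate_to (rank U) B = truncate_to (rank U) A"
      by (simp add: A truncate_truncate min_absorb1)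
    then show ?thesis using B step.IH by simp
  qed (use step.IH in simp)
qed

section \<open>Matroid axioms for the free lift and the relaxation\<close>

text \<open>If \<open>J\<close> is independent in \<open>M\<close>, any new element can be the one
  that is spared. Otherwise \<open>J\<close> really loses an element \<open>f\<close>, and
  \<open>J - {f}\<close> is still smaller than \<open>I - {e}\<close>, so augmentation in
  \<open>M\<close> applies.\<close>

lemma matroid_free_lift:
  assumes "matroid M"
  shows "matroid (free_lift M)"
proof (rule matroidI)
  fix I J
  assume "I \<in> indep (free_lift M)"
  then obtain e where I: "I \<subseteq> ground M" "I - {e} \<in> indep M" by (auto simp: free_lift_def)
  show "J \<in> indep (free_lift M)" if "J \<subseteq> I"
  proof -
    have "J - {e} \<in> indep M" by (rule matroid_hereditary[OF assms I(2)]) (use that in blast)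
    then show ?thesis using that I by (auto simp: free_lift_def)
  qed
  assume "J \<in> indep (free_lift M)" and less: "card J < card I"
  then obtain f where J: "J \<subseteq> ground M" "J - {f} \<in> indep M" by (auto simp: free_lift_def)
  have fin: "finite J" "finite I"
    using I J matroid_finite_ground[OF assms] finite_subset by auto
  have "\<exists>x \<in> I - J. \<exists>e. insert x J - {e} \<in> indep M"
  proof (cases "J \<in> indep M")
    case True
    obtain x where x: "x \<in> I - J" using less fin card_mono[of J I] by fastforce
    then have "insert x J - {x} = J" by auto
    then show ?thesis using True x by metis
  next
    case False
    then have f: "f \<in> J" using J by (metis Diff_empty Diff_insert0)
    then have "card (J - {f}) < card J" using fin by (intro card_Diff1_less)
    then have "card (J - {f}) < card (I - {e})"
      using less fin by (cases "e \<in> I") (auto simp: card_Diff_singleton)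
    then obtain x where x: "x \<in> I - {e} - (J - {f})" "insert x (J - {f}) \<in> indep M"
      using matroid_augment[OF assms I(2) J(2)] by blast
    \<comment> \<open>Augmenting by \<open>f\<close> would give back \<open>J\<close>, which is
      dependent in \<open>M\<close>.\<close>
    have "x \<noteq> f" using x False f by (auto simp: insert_absorb)
    then have "insert x J - {f} = insert x (J - {f})" "x \<in> I - J" using x by auto
    then show ?thesis using x by metis
  qed
  then show "\<exists>x \<in> I - J. insert x J \<in> indep (free_lift M)"
    using I J by (auto simp: free_lift_def)
qed (use matroidD[OF assms] in \<open>auto simp: free_lift_def\<close>)

text \<open>The conditions \<open>sub\<close> and \<open>exch\<close> are those of a
  circuit-hyperplane. The new case is augmenting \<open>J\<close> from \<open>D\<close>. If
  \<open>J\<close> contains some \<open>f\<close> outside \<open>D\<close>, it is augmented from the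
  base \<open>insert f (D - {e})\<close>; as \<open>f\<close> is already in \<open>J\<close>, the
  element found lies in \<open>D\<close>.\<close>

lemma matroid_relaxation:
  assumes M: "matroid M" and D: "D \<subseteq> ground M" "card D = rank M"
    and exch: "\<And>e f. e \<in> D \<Longrightarrow> f \<in> ground M - D \<Longrightarrow> insert f (D - {e}) \<in> indep M"
    and sub: "\<And>e. e \<in> D \<Longrightarrow> D - {e} \<in> indep M"
  shows "matroid (relaxation M D)"
proof -
  have fin: "finite D" using D matroid_finite_ground[OF M] finite_subset by blast
  have proper: "J \<in> indep M" if JD: "J \<subset> D" for J
  proof -
    obtain e where "e \<in> D" "e \<notin> J" using JD by blast
    then have "J \<subseteq> D - {e}" using JD by blast
    then show ?thesis using sub[OF \<open>e \<in> D\<close>] matroid_hereditary[OF M] by blast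
  qed
  have augD: "\<exists>x \<in> D - J. insert x J = D \<or> insert x J \<in> indep M"
    if J: "J \<in> indep M" "card J < card D" for J
  proof (cases "J \<subseteq> D")
    case True
    then have "J \<subset> D" using J(2) by blast
    then obtain x where "x \<in> D - J" by blast
    then show ?thesis using True proper[of "insert x J"] by blast
  next
    case False
    then obtain f where f: "f \<in> J" "f \<notin> D" by blast
    obtain e where e: "e \<in> D" using J by fastforce
    have fB: "insert f (D - {e}) \<in> indep M"
      using exch e f matroid_indep_subset[OF M J(1)] by blast
    have "card (insert f (D - {e})) = card D"
      using f card_Suc_Diff1[OF fin e] fin by simp
    then show ?thesis using matroid_augment[OF M fB J(1)] J f by auto
  qed
  show ?thesis
  proof (rule matroidI)
    fix I J
    assume I: "I \<in> indep (relaxation M D)"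
    show "J \<in> indep (relaxation M D)" if "J \<subseteq> I"
      using I that proper[of J] matroid_hereditary[OF M, of I J]
      by (auto simp: relaxation_def)
    assume J: "J \<in> indep (relaxation M D)" and less: "card J < card I"
    have "card I \<le> card D" using I card_le_rank[OF M] D by (auto simp: relaxation_def)
    \<comment> \<open>The set \<open>J\<close> is smaller than \<open>D\<close>, so it is not the
      added base.\<close>
    then have "J \<in> indep M" using J less by (auto simp: relaxation_def)
    then show "\<exists>x \<in> I - J. insert x J \<in> indep (relaxation M D)"
      using I augD[of J] matroid_augment[OF M, of I J] less by (auto simp: relaxation_def)
  qed (use matroidD[OF M] D in \<open>auto simp: relaxation_def\<close>)
qed

section \<open>Upper bounds on rank\<close>

lemma rank_le_insert:
  assumes "rank_le M A k" "matroid M"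
  shows "rank_le M (insert e A) (Suc k)"
  unfolding rank_le_def
proof (intro ballI impI)
  fix I assume I: "I \<in> indep M" "I \<subseteq> insert e A"
  then have "card (I - {e}) \<le> k"
    using assms matroid_hereditary[OF assms(2) I(1), of "I - {e}"] by (auto simp: rank_le_def)
  then show "card I \<le> Suc k"
    using card_Diff1_le[of I e] by (cases "e \<in> I") (auto simp: card_Diff_singleton)
qed

text \<open>The element \<open>e\<close> is spanned by \<open>A\<close>: a maximal independent
  \<open>J\<close> between \<open>Y - {e}\<close> and \<open>A\<close> cannot be augmented by
  \<open>e\<close>, which would complete \<open>Y\<close>, nor by an element of
  \<open>A\<close>.\<close>

lemma rank_le_insert_circuit:
  assumes "rank_le M A k" "matroid M"
    and Y: "Y \<notin> indep M" "Y - {e} \<in> indep M" "Y - {e} \<subseteq> A"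
  shows "rank_le M (insert e A) k"
  unfolding rank_le_def
proof (intro ballI impI)
  fix I assume I: "I \<in> indep M" "I \<subseteq> insert e A"
  define S where "S = {J \<in> indep M. Y - {e} \<subseteq> J \<and> J \<subseteq> A}"
  have "finite S" "S \<noteq> {}" using finite_indep[OF assms(2)] Y by (auto simp: S_def)
  then obtain J where J: "J \<in> S" "\<And>J'. J' \<in> S \<Longrightarrow> J \<subseteq> J' \<Longrightarrow> J = J'"
    by (meson finite_has_maximal)
  show "card I \<le> k"
  proof (rule ccontr)
    assume "\<not> card I \<le> k"
    moreover have "card J \<le> k" using J(1) assms(1) by (auto simp: S_def rank_le_def)
    ultimately obtain x where x: "x \<in> I - J" "insert x J \<in> indep M"
      using matroid_augment[OF assms(2) I(1), of J] J(1) by (auto simp: S_def)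
    show False
    proof (cases "x = e")
      case True
      then have "Y \<subseteq> insert x J" using J(1) by (auto simp: S_def)
      then show False using Y x matroid_hereditary[OF assms(2)] by blast
    next
      case False
      then have "insert x J \<in> S" using J(1) x I by (auto simp: S_def)
      then show False using J(2) x by blast
    qed
  qed
qed

text \<open>The set \<open>D\<close> spans both \<open>A\<close> and \<open>B\<close>. A larger
  independent set would augment \<open>D\<close> by one element, and the result would lie inside
  \<open>A\<close> or inside \<open>B\<close>.\<close>

lemma rank_le_Un:
  assumes "matroid M" "D \<in> indep M" "card D = k"
    and "D \<subseteq> A" "rank_le M A k" "D \<subseteq> B" "rank_le M B k"
  shows "rank_le M (A \<union> B) k"
  unfolding rank_le_def
proof (intro ballI impI, rule ccontr)
  fix I assume I: "I \<in> indep M" "I \<subseteq> A \<union> B" "\<not> card I \<le> k"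
  then obtain x where x: "x \<in> I - D" "insert x D \<in> indep M"
    using matroid_augment[OF assms(1) I(1) assms(2)] assms(3) by auto
  have "card (insert x D) = Suc k" using x assms(1-3) matroid_finite_indep by fastforce
  moreover have "insert x D \<subseteq> A \<or> insert x D \<subseteq> B" using I x assms by auto
  ultimately show False using assms(5,7) x(2) by (force simp: rank_le_def)
qed

section \<open>Existence of maximal elements\<close>

text \<open>Among the members of \<open>P\<close> above \<open>M\<close>, all on the same finite
  ground set, one with the largest number of independent sets is maximal.\<close>

lemma ex_maximal_element_above:
  assumes P: "\<And>N. N \<in> P \<Longrightarrow> matroid N" and "M \<in> P"
  shows "\<exists>N. maximal_element weak_le P N \<and> weak_le M N"
proof -
  let ?Q = "\<lambda>N. N \<in> P \<and> weak_le M N"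
  let ?b = "2 ^ card (ground M)"
  have "card (indep N) \<le> ?b" if "?Q N" for N
  proof -
    have "matroid N" "ground N = ground M" using that P by (auto simp: weak_le_def)
    then show ?thesis
      using card_mono[of "Pow (ground M)" "indep N"] matroid_indep_subset[of N]
        matroid_finite_ground[of N] by (auto simp: card_Pow)
  qed
  moreover have "?Q M" using assms by (simp add: weak_le_def)
  ultimately obtain N where N: "?Q N" "\<And>N'. ?Q N' \<Longrightarrow> card (indep N') \<le> card (indep N)"
    using ex_has_greatest_nat[of ?Q M "\<lambda>N. card (indep N)" "Suc ?b"] by (auto simp: less_Suc_eq_le)
  have "N' = N" if "N' \<in> P" "weak_le N N'" for N'
  proof -
    have "card (indep N') \<le> card (indep N)" using N that by (auto simp: weak_le_def)
    then have "indep N = indep N'"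
      using that finite_indep[OF P[OF that(1)]] card_seteq[of "indep N'" "indep N"]
      by (auto simp: weak_le_def)
    then show ?thesis using that by (cases N, cases N') (simp add: weak_le_def)
  qed
  then show ?thesis using N(1) by (auto simp: maximal_element_def)
qed

section \<open>The even cycle matroid and its linear representation\<close>

text \<open>The coordinates, one for each vertex, of a linear relation between the incidence vectors
  of the edges in \<open>F\<close>.\<close>

definition zero_sum :: "'v set set \<Rightarrow> ('v set \<Rightarrow> rat) \<Rightarrow> bool" where
  "zero_sum F w \<longleftrightarrow> (\<forall>v. (\<Sum>e \<in> {e \<in> F. v \<in> e}. w e) = 0)"

text \<open>The signed-graphic matroid of the all-negative signing: an edge is represented by its
  incidence vector, so the dependencies are the edge weightings with sum zero at each vertex.\<close>

definition even_cycle_matroid :: "'v set set \<Rightarrow> 'v set set_system" where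
  "even_cycle_matroid E =
     \<lparr>ground = E, indep = {F. F \<subseteq> E \<and> (\<forall>w. zero_sum F w \<longrightarrow> (\<forall>e \<in> F. w e = 0))}\<rparr>"

text \<open>Rational functions on the vertices, the space in which edges are represented.\<close>

interpretation rat_fun: vector_space "\<lambda>(c::rat) (f::'v \<Rightarrow> rat) x. c * f x"
  by unfold_locales (auto simp: fun_eq_iff algebra_simps)

definition incidence_vector :: "'v set \<Rightarrow> 'v \<Rightarrow> rat" where
  "incidence_vector e v = (if v \<in> e then 1 else 0)"

lemma inj_incidence_vector: "inj incidence_vector"
  by (rule injI) (metis incidence_vector_def set_eqI zero_neq_one)

lemma sum_incidence_vector:
  assumes "finite F"
  shows "(\<Sum>e \<in> F. (\<lambda>v. w e * incidence_vector e v)) v = (\<Sum>e \<in> {e \<in> F. v \<in> e}. w e)"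
proof -
  have "(\<Sum>e \<in> F. (\<lambda>v. w e * incidence_vector e v)) v = (\<Sum>e \<in> F. w e * incidence_vector e v)"
    using assms by (induction F) auto
  also have "\<dots> = (\<Sum>e \<in> F. if v \<in> e then w e else 0)"
    by (intro sum.cong) (auto simp: incidence_vector_def)
  also have "\<dots> = (\<Sum>e \<in> {e \<in> F. v \<in> e}. w e)"
    using assms by (simp add: sum.inter_filter)
  finally show ?thesis .
qed

text \<open>Since distinct edges have distinct incidence vectors, weights of edges and coefficients
  of vectors correspond to each other.\<close>

lemma indep_iff_rat_fun_independent:
  assumes "finite F"
  shows "(\<forall>w. zero_sum F w \<longrightarrow> (\<forall>e \<in> F. w e = 0)) \<longleftrightarrow>
    rat_fun.independent (incidence_vector ` F)"
proof -
  have inj: "inj_on incidence_vector F" using inj_incidence_vector by (rule inj_on_subset) simp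
  have zs: "zero_sum F w \<longleftrightarrow> (\<Sum>e \<in> F. (\<lambda>v. w e * incidence_vector e v)) = 0" for w
    unfolding zero_sum_def fun_eq_iff sum_incidence_vector[OF assms] by simp
  show ?thesis
  proof (rule iffI)
    assume L: "\<forall>w. zero_sum F w \<longrightarrow> (\<forall>e \<in> F. w e = 0)"
    show "rat_fun.independent (incidence_vector ` F)"
      unfolding rat_fun.dependent_finite[OF finite_imageI[OF assms]] sum.reindex[OF inj]
      using L[unfolded zs] by (auto simp: o_def)
  next
    assume R: "rat_fun.independent (incidence_vector ` F)"
    show "\<forall>w. zero_sum F w \<longrightarrow> (\<forall>e \<in> F. w e = 0)"
    proof (intro allI impI)
      fix w assume w: "zero_sum F w"
      \<comment> \<open>Library coefficients are attached to vectors, so the edge weights are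
        carried over along the inverse of \<open>incidence_vector\<close>.\<close>
      define u where "u = w \<circ> inv incidence_vector"
      have u: "u (incidence_vector e) = w e" for e
        by (simp add: u_def inv_f_f[OF inj_incidence_vector])
      have "(\<Sum>e \<in> F. (\<lambda>v. u (incidence_vector e) * incidence_vector e v)) = 0"
        using w unfolding zs u .
      then have "\<forall>v \<in> incidence_vector ` F. u v = 0"
        using R[unfolded rat_fun.dependent_finite[OF finite_imageI[OF assms]] sum.reindex[OF inj]]
        unfolding o_def by blast
      then show "\<forall>e \<in> F. w e = 0" by (simp add: u)
    qed
  qed
qed

text \<open>If no element of \<open>I\<close> augments \<open>J\<close>, all vectors of
  \<open>I\<close> lie in the span of those of \<open>J\<close>, against the dimension
  bound.\<close>

lemma matroid_even_cycle_matroid: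
  assumes "finite E"
  shows "matroid (even_cycle_matroid E)"
proof -
  let ?v = incidence_vector
  have eq: "F \<in> indep (even_cycle_matroid E) \<longleftrightarrow> F \<subseteq> E \<and> rat_fun.independent (?v ` F)" for F
    using indep_iff_rat_fun_independent[of F] finite_subset[OF _ assms]
    by (auto simp: even_cycle_matroid_def)
  have inj: "inj_on ?v F" for F :: "'a set set"
    using inj_incidence_vector by (rule inj_on_subset) simp
  have "\<exists>x \<in> I - J. insert x J \<subseteq> E \<and> rat_fun.independent (?v ` insert x J)"
    if I: "I \<subseteq> E" "rat_fun.independent (?v ` I)"
      and J: "J \<subseteq> E" "rat_fun.independent (?v ` J)" and less: "card J < card I" for I J
  proof (rule ccontr)
    assume no: "\<not> ?thesis"
    have "?v x \<in> rat_fun.span (?v ` J)" if "x \<in> I" for x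
    proof (cases "x \<in> J")
      case False
      then have "rat_fun.dependent (insert (?v x) (?v ` J))" using no that I J by auto
      then show ?thesis using J rat_fun.independent_insert by metis
    qed (simp add: rat_fun.span_base)
    then have "card (?v ` I) \<le> card (?v ` J)"
      using rat_fun.independent_span_bound[of "?v ` J" "?v ` I"] I J finite_subset[OF _ assms]
      by blast
    then show False using less by (simp add: card_image inj)
  qed
  note aug = this
  show ?thesis
  proof (rule matroidI)
    fix I J
    assume I: "I \<in> indep (even_cycle_matroid E)"
    show "J \<in> indep (even_cycle_matroid E)" if "J \<subseteq> I"
      using I that rat_fun.independent_mono[OF _ image_mono, of ?v I J] unfolding eq by blast
    assume "J \<in> indep (even_cycle_matroid E)" "card J < card I"
    then show "\<exists>x \<in> I - J. insert x J \<in> indep (even_cycle_matroid E)"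
      using I aug unfolding eq by blast
  qed (auto simp: even_cycle_matroid_def assms)
qed

section \<open>Explicit edge sets of K_4, K_{2,3} and the 4-cycle\<close>

lemma edges_complete_graph_iff:
  "e \<in> edges (complete_graph V) \<longleftrightarrow> (\<exists>u v. e = {u, v} \<and> u \<in> V \<and> v \<in> V \<and> u \<noteq> v)"
  by (auto simp: complete_graph_def)

lemma doubleton_mem_edges_complete_graph [simp]:
  "{u, v} \<in> edges (complete_graph V) \<longleftrightarrow> u \<in> V \<and> v \<in> V \<and> u \<noteq> v"
  by (auto simp: complete_graph_def doubleton_eq_iff)

lemma finite_edges_complete_graph: "finite V \<Longrightarrow> finite (edges (complete_graph V))"
  by (rule finite_subset[of _ "Pow V"]) (auto simp: complete_graph_def)

definition k4_edges :: "'v \<Rightarrow> 'v \<Rightarrow> 'v \<Rightarrow> 'v \<Rightarrow> 'v set set" where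
  "k4_edges a b c d = {{a, b}, {a, c}, {a, d}, {b, c}, {b, d}, {c, d}}"

definition k23_edges :: "'v \<Rightarrow> 'v \<Rightarrow> 'v \<Rightarrow> 'v \<Rightarrow> 'v \<Rightarrow> 'v set set" where
  "k23_edges a b c d e = {{a, c}, {a, d}, {a, e}, {b, c}, {b, d}, {b, e}}"

definition c4_edges :: "'v \<Rightarrow> 'v \<Rightarrow> 'v \<Rightarrow> 'v \<Rightarrow> 'v set set" where
  "c4_edges a b c d = {{a, b}, {b, c}, {c, d}, {d, a}}"

lemma edges_K4: "edges (K 4) = k4_edges 0 1 2 3"
proof (rule equalityI)
  have V: "u \<in> {..<4} \<longleftrightarrow> u = 0 \<or> u = 1 \<or> u = 2 \<or> u = 3" for u :: nat by auto
  show "edges (K 4) \<subseteq> k4_edges 0 1 2 3"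
  proof
    fix e assume "e \<in> edges (K 4)"
    then obtain u v :: nat where "e = {u, v}" "u \<in> {..<4}" "v \<in> {..<4}" "u \<noteq> v"
      unfolding edges_complete_graph_iff by blast
    then show "e \<in> k4_edges 0 1 2 3"
      unfolding V by (elim disjE) (simp_all add: k4_edges_def doubleton_eq_iff)
  qed
qed (simp add: k4_edges_def)

lemma doubleton_mem_edges_complete_bipartite_graph [simp]:
  "{u, v} \<in> edges (complete_bipartite_graph A B) \<longleftrightarrow> u \<in> A \<and> v \<in> B \<or> u \<in> B \<and> v \<in> A"
  by (auto simp: complete_bipartite_graph_def doubleton_eq_iff)

lemma edges_K23: "edges K23 = k23_edges 0 1 2 3 4"
proof (rule equalityI)
  have V: "u \<in> {..<2} \<longleftrightarrow> u = 0 \<or> u = 1" "u \<in> {2..<5} \<longleftrightarrow> u = 2 \<or> u = 3 \<or> u = 4" for u :: nat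
    by auto
  show "edges K23 \<subseteq> k23_edges 0 1 2 3 4"
  proof
    fix e assume "e \<in> edges K23"
    then obtain u v :: nat where "e = {u, v}" "u \<in> {..<2}" "v \<in> {2..<5}"
      by (auto simp: complete_bipartite_graph_def)
    then show "e \<in> k23_edges 0 1 2 3 4"
      unfolding V by (elim disjE) (simp_all add: k23_edges_def doubleton_eq_iff)
  qed
qed (simp add: k23_edges_def)

text \<open>The inverse of an isomorphism is an embedding. Conversely, the ambient graph is
  complete, so every injection of the vertices takes edges of \<open>G\<close> to edges.\<close>

lemma isomorphic_subgraph_iff:
  assumes G: "\<And>e. e \<in> edges G \<Longrightarrow> \<exists>x y. e = {x, y} \<and> x \<in> verts G \<and> y \<in> verts G \<and> x \<noteq> y"
  shows "(\<exists>H. F = edges H \<and> subgraph H (complete_graph V) \<and> graph_isomorphic H G) \<longleftrightarrow>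
    (\<exists>g. inj_on g (verts G) \<and> g ` verts G \<subseteq> V \<and> F = (`) g ` edges G)"
proof (intro iffI; elim exE conjE)
  fix H assume F: "F = edges H" and sub: "subgraph H (complete_graph V)"
    and "graph_isomorphic H G"
  then obtain f where f: "bij_betw f (verts H) (verts G)"
    and fe: "\<And>u v. u \<in> verts H \<Longrightarrow> v \<in> verts H \<Longrightarrow> {u, v} \<in> edges H \<longleftrightarrow> {f u, f v} \<in> edges G"
    by (auto simp: graph_isomorphic_def)
  define g where "g = inv_into (verts H) f"
  have g: "bij_betw g (verts G) (verts H)" using f by (simp add: g_def bij_betw_inv_into)
  have gf: "g (f u) = u" if "u \<in> verts H" for u
    using that f by (simp add: g_def bij_betw_def)
  have fg: "f (g x) = x" if "x \<in> verts G" for x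
    using that f by (metis bij_betw_inv_into_right g_def)
  have gV: "g x \<in> verts H" if "x \<in> verts G" for x
    using g that by (auto simp: bij_betw_def)
  have "edges H = (`) g ` edges G"
  proof (intro set_eqI iffI)
    fix e assume e: "e \<in> edges H"
    then obtain u v where uv: "e = {u, v}" "u \<in> verts H" "v \<in> verts H"
      using sub unfolding subgraph_def by (metis edges_complete_graph_iff insert_subset subset_iff)
    then have "{f u, f v} \<in> edges G" using fe e by blast
    moreover have "g ` {f u, f v} = e" using uv gf by auto
    ultimately show "e \<in> (`) g ` edges G" by (metis image_eqI)
  next
    fix e assume "e \<in> (`) g ` edges G"
    then obtain e' where e': "e' \<in> edges G" "e = g ` e'" by auto
    then obtain x y where xy: "e' = {x, y}" "x \<in> verts G" "y \<in> verts G" using G by blast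
    then have "{g x, g y} \<in> edges H" using fe gV fg e' by metis
    then show "e \<in> edges H" using e' xy by simp
  qed
  then show "\<exists>g. inj_on g (verts G) \<and> g ` verts G \<subseteq> V \<and> F = (`) g ` edges G"
    using g sub F by (auto simp: bij_betw_def subgraph_def complete_graph_def intro!: exI[of _ g])
next
  fix g assume g: "inj_on g (verts G)" "g ` verts G \<subseteq> V" and F: "F = (`) g ` edges G"
  let ?H = "\<lparr>verts = g ` verts G, edges = F\<rparr>"
  let ?f = "inv_into (verts G) g"
  have GV: "e \<subseteq> verts G" if "e \<in> edges G" for e using G[OF that] by auto
  have "subgraph ?H (complete_graph V)"
    unfolding subgraph_def
  proof (intro conjI ballI subsetI)
    fix e assume "e \<in> edges ?H"
    then obtain e' where e': "e' \<in> edges G" "e = g ` e'" using F by auto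
    obtain x y where "e' = {x, y}" "x \<in> verts G" "y \<in> verts G" "x \<noteq> y" using G[OF e'(1)] by blast
    then show "e \<in> edges (complete_graph V)"
      using e' g by (auto dest: inj_onD)
  next
    fix e x assume "e \<in> edges ?H" "x \<in> e"
    then show "x \<in> verts ?H" using F GV by auto
  qed (use g in \<open>auto simp: complete_graph_def\<close>)
  moreover have "graph_isomorphic ?H G"
    unfolding graph_isomorphic_def
  proof (intro exI[of _ ?f] conjI ballI)
    show "bij_betw ?f (verts ?H) (verts G)"
      using g by (simp add: inj_on_imp_bij_betw bij_betw_inv_into)
    fix u v assume "u \<in> verts ?H" "v \<in> verts ?H"
    then obtain x y where xy: "x \<in> verts G" "y \<in> verts G" "u = g x" "v = g y" by auto
    have "g ` {x, y} \<in> (`) g ` edges G \<longleftrightarrow> {x, y} \<in> edges G"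
    proof
      assume "g ` {x, y} \<in> (`) g ` edges G"
      then obtain e where e: "e \<in> edges G" "g ` {x, y} = g ` e" by (elim imageE)
      then have "{x, y} = e" using inj_on_image_eq_iff[OF g(1), of "{x, y}" e] xy GV[of e] by simp
      with e show "{x, y} \<in> edges G" by simp
    qed (rule imageI)
    then show "{u, v} \<in> edges ?H \<longleftrightarrow> {?f u, ?f v} \<in> edges G"
      using xy g F by simp
  qed
  ultimately show "\<exists>H. F = edges H \<and> subgraph H (complete_graph V) \<and> graph_isomorphic H G"
    by (metis graph.select_convs(2))
qed

text \<open>An embedding of K_4 or K_{2,3} is recorded by the images of the vertices 0, 1, ...,
  which replaces isomorphism by concrete edge lists.\<close>

lemma X_family_iff:
  "F \<in> X_family n \<longleftrightarrow>
    (\<exists>a b c d. distinct [a, b, c, d] \<and> {a, b, c, d} \<subseteq> {..<n} \<and> F = k4_edges a b c d) \<or>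
    (\<exists>a b c d e. distinct [a, b, c, d, e] \<and> {a, b, c, d, e} \<subseteq> {..<n} \<and> F = k23_edges a b c d e)"
    (is "_ \<longleftrightarrow> ?K4 \<or> ?K23")
proof -
  have V4: "verts (K 4) = {0, 1, 2, 3}" by (auto simp: complete_graph_def)
  have V5: "verts K23 = {0, 1, 2, 3, 4}" by (auto simp: complete_bipartite_graph_def)
  have "F \<in> X_family n \<longleftrightarrow>
    (\<exists>H. F = edges H \<and> subgraph H (K n) \<and> graph_isomorphic H (K 4)) \<or>
    (\<exists>H. F = edges H \<and> subgraph H (K n) \<and> graph_isomorphic H K23)"
    by (auto simp: X_family_def)
  also have "(\<exists>H. F = edges H \<and> subgraph H (K n) \<and> graph_isomorphic H (K 4)) \<longleftrightarrow>
     (\<exists>g. inj_on g (verts (K 4)) \<and> g ` verts (K 4) \<subseteq> {..<n} \<and> F = (`) g ` edges (K 4))"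
    by (rule isomorphic_subgraph_iff) (auto simp: complete_graph_def)
  also have "\<dots> \<longleftrightarrow> ?K4"
    unfolding V4 edges_K4
  proof (intro iffI; elim exE conjE)
    fix g :: "nat \<Rightarrow> nat"
    assume "inj_on g {0, 1, 2, 3}" "g ` {0, 1, 2, 3} \<subseteq> {..<n}" "F = (`) g ` k4_edges 0 1 2 3"
    then show ?K4
      by (intro exI[of _ "g 0"] exI[of _ "g 1"] exI[of _ "g 2"] exI[of _ "g 3"])
        (simp add: k4_edges_def)
  next
    fix a b c d
    assume "distinct [a, b, c, d]" "{a, b, c, d} \<subseteq> {..<n}" "F = k4_edges a b c d"
    then show "\<exists>g. inj_on g {0, 1, 2, 3} \<and> g ` {0, 1, 2, 3} \<subseteq> {..<n} \<and>
        F = (`) g ` k4_edges 0 1 2 (3::nat)"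
      \<comment> \<open>Indexing into the list of chosen vertices is the required injection.\<close>
      by (intro exI[of _ "(!) [a, b, c, d]"]) (simp add: k4_edges_def)
  qed
  also have "(\<exists>H. F = edges H \<and> subgraph H (K n) \<and> graph_isomorphic H K23) \<longleftrightarrow>
     (\<exists>g. inj_on g (verts K23) \<and> g ` verts K23 \<subseteq> {..<n} \<and> F = (`) g ` edges K23)"
    by (rule isomorphic_subgraph_iff) (fastforce simp: complete_bipartite_graph_def)
  also have "\<dots> \<longleftrightarrow> ?K23"
    unfolding V5 edges_K23
  proof (intro iffI; elim exE conjE)
    fix g :: "nat \<Rightarrow> nat"
    assume "inj_on g {0, 1, 2, 3, 4}" "g ` {0, 1, 2, 3, 4} \<subseteq> {..<n}"
      "F = (`) g ` k23_edges 0 1 2 3 4"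
    then show ?K23
      by (intro exI[of _ "g 0"] exI[of _ "g 1"] exI[of _ "g 2"] exI[of _ "g 3"] exI[of _ "g 4"])
        (simp add: k23_edges_def)
  next
    fix a b c d e
    assume "distinct [a, b, c, d, e]" "{a, b, c, d, e} \<subseteq> {..<n}" "F = k23_edges a b c d e"
    then show "\<exists>g. inj_on g {0, 1, 2, 3, 4} \<and> g ` {0, 1, 2, 3, 4} \<subseteq> {..<n} \<and>
        F = (`) g ` k23_edges 0 1 2 3 (4::nat)"
      by (intro exI[of _ "(!) [a, b, c, d, e]"]) (simp add: k23_edges_def)
  qed
  finally show ?thesis .
qed

lemma card_X_family: "F \<in> X_family n \<Longrightarrow> card F = 6"
  by (auto simp: X_family_iff k4_edges_def k23_edges_def doubleton_eq_iff)

lemma X_family_subset: "F \<in> X_family n \<Longrightarrow> F \<subseteq> edges (K n)"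
  by (auto simp: X_family_def subgraph_def)

section \<open>Dependencies on at most six edges\<close>

lemma zero_sum_iff:
  "finite F \<Longrightarrow> zero_sum F w \<longleftrightarrow> (\<forall>v. (\<Sum>e \<in> F. if v \<in> e then w e else 0) = 0)"
  by (simp add: zero_sum_def sum.inter_filter)

lemma zero_sum_superset:
  assumes "finite F" "G \<subseteq> F" "zero_sum G w"
  shows "zero_sum F (\<lambda>e. if e \<in> G then w e else 0)"
proof -
  have "(\<Sum>e \<in> {e \<in> F. v \<in> e}. if e \<in> G then w e else 0) = (\<Sum>e \<in> {e \<in> G. v \<in> e}. w e)" for v
    using assms by (intro sum.mono_neutral_cong_right) auto
  then show ?thesis using assms(3) by (simp add: zero_sum_def)
qed

text \<open>This applies the linear functional with values \<open>\<phi>\<close> on the unit vectors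
  to the relation \<open>w\<close>; exchanging the two sums collects the equation at each
  vertex.\<close>

lemma zero_sum_functional:
  assumes "finite F" "\<And>e. e \<in> F \<Longrightarrow> finite e" "zero_sum F w"
  shows "(\<Sum>e \<in> F. w e * (\<Sum>v \<in> e. \<phi> v)) = 0"
proof -
  have "(\<Sum>e \<in> F. w e * (\<Sum>v \<in> e. \<phi> v)) = (\<Sum>e \<in> F. \<Sum>v \<in> \<Union>F. if v \<in> e then w e * \<phi> v else 0)"
  proof (rule sum.cong[OF refl])
    fix e assume "e \<in> F"
    then have "{v \<in> \<Union>F. v \<in> e} = e" by auto
    then show "w e * (\<Sum>v \<in> e. \<phi> v) = (\<Sum>v \<in> \<Union>F. if v \<in> e then w e * \<phi> v else 0)"
      using assms by (simp add: sum.inter_filter[symmetric] sum_distrib_left)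
  qed
  also have "\<dots> = (\<Sum>v \<in> \<Union>F. \<Sum>e \<in> F. if v \<in> e then w e * \<phi> v else 0)" by (rule sum.swap)
  also have "\<dots> = (\<Sum>v \<in> \<Union>F. \<phi> v * (\<Sum>e \<in> F. if v \<in> e then w e else 0))"
    by (intro sum.cong) (auto simp: sum_distrib_left intro!: sum.cong)
  also have "\<dots> = 0" using assms by (simp add: zero_sum_iff)
  finally show ?thesis .
qed

text \<open>Weights alternating between 1 and -1 around a 4-cycle cancel at every vertex.\<close>

lemma c4_edges_dependent:
  assumes "finite E" "distinct [a, b, c, d]" "c4_edges a b c d \<subseteq> F"
  shows "F \<notin> indep (even_cycle_matroid E)"
proof
  assume "F \<in> indep (even_cycle_matroid E)"
  then have "c4_edges a b c d \<in> indep (even_cycle_matroid E)"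
    using matroid_hereditary[OF matroid_even_cycle_matroid] assms by blast
  moreover define w :: "'a set \<Rightarrow> rat" where
    "w e = (if e = {a, b} \<or> e = {c, d} then 1 else - 1)" for e
  have "zero_sum (c4_edges a b c d) w"
    using assms(2) by (auto simp: zero_sum_iff c4_edges_def w_def doubleton_eq_iff)
  ultimately have "w {a, b} = 0"
    by (auto simp: even_cycle_matroid_def c4_edges_def)
  then show False by (simp add: w_def)
qed

text \<open>The support \<open>S\<close> of a dependency has no vertex of degree one, and over the
  rationals an odd cycle alone carries no dependency. With at most five edges this leaves only
  supports that contain a 4-cycle.\<close>

lemma small_dependent_contains_c4:
  assumes F: "F \<subseteq> edges (complete_graph V)" "finite F" "card F \<le> 5"
    and dep: "zero_sum F w" "e0 \<in> F" "w e0 \<noteq> 0"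
  shows "\<exists>a b c d. distinct [a, b, c, d] \<and> c4_edges a b c d \<subseteq> F"
proof -
  define S where "S = {e \<in> F. w e \<noteq> 0}"
  have SF: "S \<subseteq> F" and finS: "finite S" using F by (auto simp: S_def)
  have cS: "card S \<le> 5" using card_mono[OF F(2) SF] F(3) by simp
  have zS: "zero_sum S w"
  proof -
    have "(\<Sum>e \<in> {e \<in> S. v \<in> e}. w e) = (\<Sum>e \<in> {e \<in> F. v \<in> e}. w e)" for v
      using F by (intro sum.mono_neutral_left) (auto simp: S_def)
    then show ?thesis using dep(1) by (simp add: zero_sum_def)
  qed
  have SV: "e \<in> edges (complete_graph V)" if "e \<in> S" for e using that SF F(1) by blast
  have ne: "u \<noteq> v" if "{u, v} \<in> S" for u v
    using SV[OF that] unfolding doubleton_mem_edges_complete_graph by blast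
  have comm: "{v, u} \<in> S" if "{u, v} \<in> S" for u v using that by (simp add: insert_commute)
  have pair: "\<exists>u v. e = {u, v} \<and> u \<noteq> v" if "e \<in> S" for e
    using SV[OF that] unfolding edges_complete_graph_iff by blast
  \<comment> \<open>At a vertex of degree one the zero sum would make the weight of its only edge
    vanish.\<close>
  have nb: "\<exists>x. x \<noteq> v \<and> x \<noteq> u \<and> {u, x} \<in> S" if uv: "{u, v} \<in> S" for u v
  proof (rule ccontr)
    assume no: "\<not> ?thesis"
    have "e = {u, v}" if e: "e \<in> S" "u \<in> e" for e
    proof -
      obtain x where "e = {u, x}" "u \<noteq> x" using pair[OF e(1)] e(2) by auto
      then show ?thesis using no e by auto
    qed
    then have "{e \<in> S. u \<in> e} = {{u, v}}" using uv by blast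
    then have "w {u, v} = 0" using zS[unfolded zero_sum_def, rule_format, of u] by simp
    then show False using uv by (simp add: S_def)
  qed
  \<comment> \<open>Five edges found in the support exhaust it, so every later edge must be among
    them.\<close>
  have full: "S = T" if "T \<subseteq> S" "card T = 5" for T
    using card_seteq[OF finS that(1)] cS that(2) by simp
  let ?C4 = "\<exists>a b c d. distinct [a, b, c, d] \<and> c4_edges a b c d \<subseteq> S"
  have C4I: ?C4 if "distinct [a, b, c, d]" "{a, b} \<in> S" "{b, c} \<in> S" "{c, d} \<in> S" "{d, a} \<in> S"
    for a b c d
    using that unfolding c4_edges_def by blast
  have triangle: ?C4 if t: "{p, q} \<in> S" "{q, r} \<in> S" "{p, r} \<in> S" "distinct [p, q, r]" for p q r
  proof -
    let ?T = "{{p, q}, {q, r}, {p, r}}"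
    have wt: "w {p, q} \<noteq> 0" using t by (simp add: S_def)
    \<comment> \<open>On an odd cycle the vertex equations have only the zero solution.\<close>
    have "S \<noteq> ?T"
    proof
      assume "S = ?T"
      then have z: "(\<Sum>e \<in> ?T. if v \<in> e then w e else 0) = 0" for v
        using zS finS by (simp add: zero_sum_iff)
      have "w {p, q} = 0"
        using z[of p] z[of q] z[of r] t(4) by (auto simp: doubleton_eq_iff)
      with wt show False ..
    qed
    then obtain e where e: "e \<in> S" "e \<notin> ?T" using t by blast
    obtain x0 y0 where xy0: "e = {x0, y0}" "x0 \<noteq> y0" using pair[OF e(1)] by blast
    then have "x0 \<notin> {p, q, r} \<or> y0 \<notin> {p, q, r}" using e(2) by (auto simp: doubleton_eq_iff)
    then obtain x y where xy: "{x, y} \<in> S" "x \<notin> {p, q, r}"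
      using e(1) comm unfolding xy0 by blast
    have xny: "x \<noteq> y" using ne[OF xy(1)] .
    obtain y' where y': "y' \<noteq> y" "y' \<noteq> x" "{x, y'} \<in> S" using nb[OF xy(1)] by blast
    \<comment> \<open>The vertex \<open>x\<close> off the triangle has two edges. Their other ends
      also have degree at least two, which forces them onto the triangle; the third triangle vertex
      \<open>t\<close> then closes a 4-cycle.\<close>
    have S: "S = {{p, q}, {q, r}, {p, r}, {x, y}, {x, y'}}"
      using xy y' t by (intro full) (auto simp: doubleton_eq_iff)
    have "y \<in> {p, q, r}"
    proof (rule ccontr)
      assume y: "y \<notin> {p, q, r}"
      obtain z where "z \<noteq> x" "z \<noteq> y" "{y, z} \<in> S" using nb[OF comm[OF xy(1)]] by blast
      then show False unfolding S using y y' xy xny by (auto simp: doubleton_eq_iff)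
    qed
    moreover have "y' \<in> {p, q, r}"
    proof (rule ccontr)
      assume y: "y' \<notin> {p, q, r}"
      obtain z where "z \<noteq> x" "z \<noteq> y'" "{y', z} \<in> S" using nb[OF comm[OF y'(3)]] by blast
      then show False unfolding S using y y' xy xny by (auto simp: doubleton_eq_iff)
    qed
    ultimately obtain t where "t \<in> {p, q, r}" "t \<noteq> y" "t \<noteq> y'" "{y, t} \<in> S" "{t, y'} \<in> S"
      using t y' comm by auto
    then show ?C4
      using xy y' ne comm by (intro C4I[of x y t y']) auto
  qed
  have ?C4
  proof -
    obtain u v where uv: "{u, v} \<in> S" "u \<noteq> v" using pair[of e0] dep by (auto simp: S_def)
    then obtain a where a: "a \<noteq> v" "a \<noteq> u" "{u, a} \<in> S" using nb by blast
    obtain b where b: "b \<noteq> v" "b \<noteq> u" "{v, b} \<in> S"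
      using nb[OF comm[OF uv(1)]] by blast
    obtain c where c: "c \<noteq> u" "c \<noteq> a" "{a, c} \<in> S"
      using nb[OF comm[OF a(3)]] by blast
    obtain d where d: "d \<noteq> v" "d \<noteq> b" "{b, d} \<in> S"
      using nb[OF comm[OF b(3)]] by blast
    \<comment> \<open>The path \<open>a\<close>, \<open>u\<close>, \<open>v\<close>,
      \<open>b\<close> is prolonged by \<open>c\<close> at \<open>a\<close> and by \<open>d\<close>
      at \<open>b\<close>. The first three cases yield a triangle, the next two a 4-cycle; in the
      last one the five edges exhaust the support.\<close>
    consider "a = b" | "c = v" | "d = u" | "a \<noteq> b" "c = b" | "a \<noteq> b" "d = a"
      | "a \<noteq> b" "c \<notin> {v, b}" "d \<notin> {u, a}" by blast
    then show ?thesis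
    proof cases
      case 1
      then show ?thesis using triangle[of u v a] uv a b by auto
    next
      case 2
      then show ?thesis using triangle[of u v a] uv a c by (auto simp: insert_commute)
    next
      case 3
      then show ?thesis using triangle[of u v b] uv b d by (auto simp: insert_commute)
    next
      case 4
      then show ?thesis using C4I[of a u v b] uv a b c by (auto simp: insert_commute)
    next
      case 5
      then show ?thesis using C4I[of a u v b] uv a b d by (auto simp: insert_commute)
    next
      case 6
      have S: "S = {{u, v}, {u, a}, {v, b}, {a, c}, {b, d}}"
        using 6 uv a b c d by (intro full) (auto simp: doubleton_eq_iff)
      obtain x where "x \<noteq> a" "x \<noteq> c" "{c, x} \<in> S"
        using nb[OF comm[OF c(3)]] by blast
      \<comment> \<open>A second edge at \<open>c\<close> can only be \<open>{b, d}\<close>, so the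
        support is a 5-cycle, again odd.\<close>
      then have "c = d" using 6 a b c d uv unfolding S by (auto simp: doubleton_eq_iff)
      with S have z:
        "(\<Sum>e \<in> {{u, v}, {u, a}, {v, b}, {a, c}, {b, c}}. if y \<in> e then w e else 0) = 0" for y
        using zS finS by (simp add: zero_sum_iff)
      have "w {u, v} = 0"
        using z[of u] z[of v] z[of a] z[of b] z[of c] 6 a b c uv by (auto simp: doubleton_eq_iff)
      then show ?thesis using uv by (simp add: S_def)
    qed
  qed
  then show ?thesis using SF by (meson subset_trans)
qed

text \<open>If the second 4-cycle leaves the vertices of the first, its two edges at a new vertex
  complete \<open>F\<close> to a K_{2,3}; otherwise both diagonals of the first cycle are present
  and \<open>F\<close> is a K_4.\<close>

lemma two_c4_in_X_family:
  assumes F: "F \<subseteq> edges (K n)" "card F \<le> 6"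
    and C: "distinct [a, b, c, d]" "c4_edges a b c d \<subseteq> F"
    and C': "distinct [p, q, r, s]" "c4_edges p q r s \<subseteq> F - {{a, b}}"
  shows "F \<in> X_family n"
proof -
  have finF: "finite F" using F(1) finite_edges_complete_graph[of "{..<n}"] finite_subset by blast
  have full: "F = T" if "T \<subseteq> F" "card T = 6" for T
    using card_seteq[OF finF that(1)] F(2) that(2) by simp
  have lt: "x < n" if "{x, y} \<in> F" for x y using that F(1) by auto
  have new: "F \<in> X_family n"
    if d: "distinct [p, q, r, s]" "c4_edges p q r s \<subseteq> F" "p \<notin> {a, b, c, d}" for p q r s
  proof -
    have S: "F = {{a, b}, {b, c}, {c, d}, {d, a}, {p, q}, {p, s}}"
      using d C by (intro full) (auto simp: c4_edges_def doubleton_eq_iff insert_commute)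
    have "{q, r} \<in> F" "{r, s} \<in> F" using d by (auto simp: c4_edges_def)
    \<comment> \<open>The vertex \<open>r\<close> differs from \<open>p\<close>, so
      \<open>q\<close>, \<open>r\<close>, \<open>s\<close> is a path on the first cycle and
      \<open>q\<close>, \<open>s\<close> are opposite vertices of it.\<close>
    then have "(q = a \<and> s = c) \<or> (q = c \<and> s = a) \<or> (q = b \<and> s = d) \<or> (q = d \<and> s = b)"
      unfolding S using d C(1) by (auto simp: doubleton_eq_iff)
    moreover have "F = k23_edges a c b d p" if "(q = a \<and> s = c) \<or> (q = c \<and> s = a)"
      using that unfolding S k23_edges_def by (elim disjE conjE) (simp_all add: insert_commute)
    moreover have "F = k23_edges b d a c p" if "(q = b \<and> s = d) \<or> (q = d \<and> s = b)"
      using that unfolding S k23_edges_def by (elim disjE conjE) (simp_all add: insert_commute)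
    ultimately have "F = k23_edges a c b d p \<or> F = k23_edges b d a c p" by blast
    moreover have "distinct [a, c, b, d, p]" "distinct [b, d, a, c, p]" using C d by auto
    moreover have "a < n" "b < n" "c < n" "d < n" "p < n"
      using lt[of a b] lt[of b c] lt[of c d] lt[of d a] lt[of p q] unfolding S by auto
    then have "{a, c, b, d, p} \<subseteq> {..<n}" "{b, d, a, c, p} \<subseteq> {..<n}" by auto
    ultimately show ?thesis unfolding X_family_iff by blast
  qed
  have C'F: "c4_edges p q r s \<subseteq> F" using C' by blast
  \<comment> \<open>A rotation of the second cycle moves a new vertex to the front.\<close>
  consider "p \<notin> {a, b, c, d}" | "q \<notin> {a, b, c, d}" | "r \<notin> {a, b, c, d}" | "s \<notin> {a, b, c, d}"
    | "{p, q, r, s} \<subseteq> {a, b, c, d}" by blast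
  then show ?thesis
  proof cases
    case 1 then show ?thesis using new C'(1) C'F by blast
  next
    case 2 then show ?thesis using new[of q r s p] C'(1) C'F by (auto simp: c4_edges_def)
  next
    case 3 then show ?thesis using new[of r s p q] C'(1) C'F by (auto simp: c4_edges_def)
  next
    case 4 then show ?thesis using new[of s p q r] C'(1) C'F by (auto simp: c4_edges_def)
  next
    case 5
    \<comment> \<open>Of the three 4-cycles on four vertices, the only one that avoids
      \<open>{a, b}\<close> uses both diagonals.\<close>
    have "{a, c} \<in> F \<and> {b, d} \<in> F"
      using 5 C' by (auto simp: c4_edges_def doubleton_eq_iff insert_commute)
    then have "F = k4_edges a b c d"
      using C by (intro full) (auto simp: c4_edges_def k4_edges_def doubleton_eq_iff insert_commute)
    moreover have "a < n" "b < n" "c < n" "d < n"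
      using lt[of a b] lt[of b c] lt[of c d] lt[of d a] C by (auto simp: c4_edges_def)
    then have "{a, b, c, d} \<subseteq> {..<n}" by auto
    ultimately show ?thesis unfolding X_family_iff using C(1) by blast
  qed
qed

section \<open>The given matroid as a truncation of the free lift\<close>

abbreviation even_cycle_K :: "nat \<Rightarrow> nat set set_system" where
  "even_cycle_K n \<equiv> even_cycle_matroid (edges (K n))"

lemma ground_even_cycle_matroid [simp]: "ground (even_cycle_matroid E) = E"
  by (simp add: even_cycle_matroid_def)

lemma matroid_even_cycle_K: "matroid (even_cycle_K n)"
  by (simp add: matroid_even_cycle_matroid finite_edges_complete_graph)

text \<open>Both K_4 and K_{2,3} contain three 4-cycles without a common edge, so one of them avoids
  \<open>e\<close>.\<close>

lemma X_family_dependent: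
  assumes "F \<in> X_family n"
  shows "F - {e} \<notin> indep (even_cycle_K n)"
proof -
  have "\<exists>p q r s. distinct [p, q, r, s] \<and> c4_edges p q r s \<subseteq> F \<and> e \<notin> c4_edges p q r s"
    using assms unfolding X_family_iff
  proof (elim disjE exE conjE)
    fix a b c d assume d: "distinct [a, b, c, d]" and F: "F = k4_edges a b c d"
    have "e \<notin> c4_edges a c b d \<or> e \<notin> c4_edges a b d c" if "e \<in> c4_edges a b c d"
      using that unfolding c4_edges_def insert_iff empty_iff
      by (elim disjE) (use d in \<open>auto simp: doubleton_eq_iff\<close>)
    moreover have "c4_edges a b c d \<subseteq> F" "c4_edges a c b d \<subseteq> F" "c4_edges a b d c \<subseteq> F"
      unfolding F by (auto simp: c4_edges_def k4_edges_def insert_commute)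
    moreover have "distinct [a, c, b, d]" "distinct [a, b, d, c]" using d by auto
    ultimately show ?thesis using d by blast
  next
    fix a b c d f assume d: "distinct [a, b, c, d, f]" and F: "F = k23_edges a b c d f"
    have "e \<notin> c4_edges a c b f \<or> e \<notin> c4_edges a d b f" if "e \<in> c4_edges a c b d"
      using that unfolding c4_edges_def insert_iff empty_iff
      by (elim disjE) (use d in \<open>auto simp: doubleton_eq_iff\<close>)
    moreover have "c4_edges a c b d \<subseteq> F" "c4_edges a c b f \<subseteq> F" "c4_edges a d b f \<subseteq> F"
      unfolding F by (auto simp: c4_edges_def k23_edges_def insert_commute)
    moreover have "distinct [a, c, b, d]" "distinct [a, c, b, f]" "distinct [a, d, b, f]"
      using d by auto
    ultimately show ?thesis by blast
  qed
  then show ?thesis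
    using c4_edges_dependent[OF finite_edges_complete_graph[OF finite_lessThan]] by blast
qed

text \<open>Dependence in the lift means that \<open>F\<close> stays dependent after the loss of any
  one edge. The at most five edges left then contain a 4-cycle.\<close>

lemma U_matroid_eq_truncate: "U_matroid n = truncate_to 6 (free_lift (even_cycle_K n))"
proof -
  have *: "F \<in> X_family n"
    if F: "F \<subseteq> edges (K n)" "card F \<le> 6" and no: "\<And>e. F - {e} \<notin> indep (even_cycle_K n)" for F
  proof -
    have finF: "finite F"
      using F(1) finite_edges_complete_graph[of "{..<n}"] finite_subset by blast
    have c4: "\<exists>a b c d. distinct [a, b, c, d] \<and> c4_edges a b c d \<subseteq> F - {e}" if e: "e \<in> F" for e
    proof -
      have "card (F - {e}) \<le> 5" using e F(2) finF by (simp add: card_Diff_singleton)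
      moreover have "F - {e} \<subseteq> edges (K n)" using F(1) by blast
      moreover obtain w e' where "zero_sum (F - {e}) w" "e' \<in> F - {e}" "w e' \<noteq> 0"
        using no[of e] F(1) by (auto simp: even_cycle_matroid_def)
      ultimately show ?thesis using small_dependent_contains_c4 finF by blast
    qed
    have "F \<noteq> {}" using no[of undefined] matroid_empty[OF matroid_even_cycle_K, of n] by auto
    then obtain a b c d where C: "distinct [a, b, c, d]" "c4_edges a b c d \<subseteq> F"
      using c4 by blast
    then have "{a, b} \<in> F" by (simp add: c4_edges_def)
    \<comment> \<open>The removal of an edge of the first 4-cycle exhibits a second one.\<close>
    then show ?thesis using c4 two_c4_in_X_family[OF F C] by blast
  qed
  have "{F. F \<subseteq> edges (K n) \<and> card F \<le> 6 \<and> F \<notin> X_family n} =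
    {I \<in> {I. I \<subseteq> edges (K n) \<and> (\<exists>e. I - {e} \<in> indep (even_cycle_K n))}. card I \<le> 6}"
    (is "{F. ?l F} = {I \<in> {I. ?r I}. card I \<le> 6}")
  proof (intro Collect_cong iffI; elim conjE)
    fix F assume "F \<subseteq> edges (K n)" "card F \<le> 6" "F \<notin> X_family n"
    then show "F \<in> {I. ?r I} \<and> card F \<le> 6" using *[of F] by blast
  next
    fix F assume "F \<in> {I. ?r I}" "card F \<le> 6"
    then show "?l F" using X_family_dependent[of F n] by blast
  qed
  then show ?thesis by (simp add: U_matroid_def truncate_to_def free_lift_def)
qed

section \<open>Two disjoint 4-cycles, and nine independent edges in the lift\<close>

text \<open>The set \<open>D\<close> of the overview: the 4-cycles 0-2-1-3 and 4-6-5-7.\<close>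

definition two_c4 :: "nat set set" where
  "two_c4 = {{0, 2}, {0, 3}, {1, 2}, {1, 3}, {4, 6}, {4, 7}, {5, 6}, {5, 7}}"

lemma card_two_c4: "card two_c4 = 8"
  by (simp add: two_c4_def doubleton_eq_iff)

lemma two_c4_subset: "8 \<le> n \<Longrightarrow> two_c4 \<subseteq> edges (K n)"
  by (simp add: two_c4_def)

text \<open>By \<open>sep\<close>, \<open>e\<close> is on the first cycle and \<open>e'\<close> on
  the second. A functional kills the weight of \<open>f\<close>; what remains is a dependency on the
  two cycles that vanishes on an edge of each.\<close>

lemma two_c4_exchange_aux:
  assumes ee': "e \<in> two_c4" "e' \<in> two_c4" and sep: "0 \<in> e \<or> 1 \<in> e" "4 \<in> e' \<or> 5 \<in> e'"
    and f: "f \<in> edges (K n) - two_c4" and n: "8 \<le> n"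
  shows "insert f (two_c4 - {e, e'}) \<in> indep (even_cycle_K n)"
proof -
  let ?G = "insert f (two_c4 - {e, e'})"
  have "w x = 0" if w: "zero_sum ?G w" and x: "x \<in> ?G" for w x
  proof -
    \<comment> \<open>Extended by zero, the dependency lives on a fixed list of edges.\<close>
    define w' where "w' = (\<lambda>x. if x \<in> ?G then w x else 0)"
    have fin: "finite (insert f two_c4)" by (simp add: two_c4_def)
    have zs: "zero_sum (insert f two_c4) w'"
      unfolding w'_def using w fin by (intro zero_sum_superset) auto
    obtain p q where pq: "f = {p, q}" "p \<noteq> q"
      using f by (auto simp: edges_complete_graph_iff)
    \<comment> \<open>A functional that vanishes on the incidence vectors of \<open>two_c4\<close> and on those of no
      other edges, which shows that \<open>two_c4\<close> is a flat.\<close>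
    define \<phi> :: "nat \<Rightarrow> rat" where "\<phi> v = (if v < 2 then 1 else if v < 4 then - 1
      else if v < 6 then 2 else if v < 8 then - 2 else 5)" for v
    have "(\<Sum>e \<in> insert f two_c4. w' e * (\<Sum>v \<in> e. \<phi> v)) = 0"
      using fin zs pq by (intro zero_sum_functional) (auto simp: two_c4_def)
    moreover have "(\<Sum>e \<in> two_c4. w' e * (\<Sum>v \<in> e. \<phi> v)) = 0"
      by (intro sum.neutral ballI) (auto simp: two_c4_def \<phi>_def)
    ultimately have "w' f * (\<phi> p + \<phi> q) = 0"
      using f fin pq by simp
    moreover have "\<phi> p + \<phi> q \<noteq> 0"
    proof
      assume s: "\<phi> p + \<phi> q = 0"
      have "p < 2 \<and> 2 \<le> q \<and> q < 4 \<or> q < 2 \<and> 2 \<le> p \<and> p < 4 \<or>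
        4 \<le> p \<and> p < 6 \<and> 6 \<le> q \<and> q < 8 \<or> 4 \<le> q \<and> q < 6 \<and> 6 \<le> p \<and> p < 8"
        using s unfolding \<phi>_def by (simp split: if_splits)
      moreover have "x < 2 \<Longrightarrow> x = 0 \<or> x = 1" "2 \<le> x \<Longrightarrow> x < 4 \<Longrightarrow> x = 2 \<or> x = 3"
        "4 \<le> x \<Longrightarrow> x < 6 \<Longrightarrow> x = 4 \<or> x = 5" "6 \<le> x \<Longrightarrow> x < 8 \<Longrightarrow> x = 6 \<or> x = 7" for x :: nat
        by linarith+
      ultimately have "(p = 0 \<or> p = 1) \<and> (q = 2 \<or> q = 3) \<or> (q = 0 \<or> q = 1) \<and> (p = 2 \<or> p = 3) \<or>
        (p = 4 \<or> p = 5) \<and> (q = 6 \<or> q = 7) \<or> (q = 4 \<or> q = 5) \<and> (p = 6 \<or> p = 7)"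
        by blast
      then have "f \<in> two_c4"
        unfolding pq two_c4_def by (elim disjE conjE) (simp_all add: doubleton_eq_iff)
      then show False using f by blast
    qed
    ultimately have wf: "w' f = 0" by simp
    have z: "(\<Sum>x \<in> two_c4. if v \<in> x then w' x else 0) = 0" for v
      using zs[unfolded zero_sum_iff[OF fin], rule_format, of v] f fin wf
      by (simp split: if_splits)
    have we: "w' e = 0" "w' e' = 0" using ee' f by (auto simp: w'_def)
    \<comment> \<open>The weights alternate in sign around each cycle, so one zero weight makes the
      whole cycle vanish.\<close>
    have "w' {0, 2} = 0 \<and> w' {0, 3} = 0 \<and> w' {1, 2} = 0 \<and> w' {1, 3} = 0"
      using we(1) ee'(1) sep(1) z[of 0] z[of 1] z[of 2] z[of 3]
      by (auto simp: two_c4_def doubleton_eq_iff)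
    moreover have "w' {4, 6} = 0 \<and> w' {4, 7} = 0 \<and> w' {5, 6} = 0 \<and> w' {5, 7} = 0"
      using we(2) ee'(2) sep(2) z[of 4] z[of 5] z[of 6] z[of 7]
      by (auto simp: two_c4_def doubleton_eq_iff)
    ultimately have "\<forall>y \<in> two_c4. w' y = 0" by (simp add: two_c4_def)
    then have "w' x = 0" using wf x by blast
    then show ?thesis using x by (simp add: w'_def)
  qed
  moreover have "?G \<subseteq> edges (K n)" using f two_c4_subset[OF n] by blast
  ultimately show ?thesis by (simp add: even_cycle_matroid_def)
qed

text \<open>The lift spares one more edge \<open>e'\<close>, which is taken from the cycle that does
  not contain \<open>e\<close>. This supplies the exchange condition for relaxing
  \<open>two_c4\<close>.\<close>

lemma two_c4_exchange:
  assumes "e \<in> two_c4" "f \<in> edges (K n) - two_c4" "8 \<le> n"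
  shows "insert f (two_c4 - {e}) \<in> indep (free_lift (even_cycle_K n))"
proof -
  have "\<exists>e'. insert f (two_c4 - {e, e'}) \<in> indep (even_cycle_K n) \<and> e' \<noteq> f"
  proof (cases "0 \<in> e \<or> 1 \<in> e")
    case True
    have "{4, 6} \<in> two_c4" by (simp add: two_c4_def)
    then show ?thesis using True two_c4_exchange_aux[of e "{4, 6}" f n] assms by blast
  next
    case False
    then have "4 \<in> e \<or> 5 \<in> e" using assms(1) by (auto simp: two_c4_def)
    moreover have "{0, 2} \<in> two_c4" by (simp add: two_c4_def)
    ultimately show ?thesis
      using two_c4_exchange_aux[of "{0, 2}" e f n] assms by (auto simp: insert_commute)
  qed
  then obtain e' where e': "insert f (two_c4 - {e, e'}) \<in> indep (even_cycle_K n)" "e' \<noteq> f"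
    by blast
  have "insert f (two_c4 - {e}) - {e'} = insert f (two_c4 - {e, e'})" using e'(2) by auto
  moreover have "insert f (two_c4 - {e}) \<subseteq> edges (K n)"
    using assms(2) two_c4_subset[OF assms(3)] by blast
  ultimately show ?thesis using e'(1)
    by (simp add: free_lift_def) metis
qed

text \<open>A spanning tree of K_{2,2,2,2} with parts 01, 23, 45, 67, together with
  \<open>{2, 4}\<close> and \<open>{2, 6}\<close>, each of which closes a triangle with 0.\<close>

definition nine_edges :: "nat set set" where
  "nine_edges = {{0, 2}, {0, 3}, {0, 4}, {0, 5}, {0, 6}, {0, 7}, {1, 2}, {2, 4}, {2, 6}}"

lemma card_nine_edges: "card nine_edges = 9"
  by (simp add: nine_edges_def doubleton_eq_iff)

text \<open>A tree with one extra edge closing an odd cycle is independent in the even cycle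
  matroid, and the lift spares \<open>{2, 6}\<close>.\<close>

lemma nine_edges_indep:
  assumes "8 \<le> n"
  shows "nine_edges \<in> indep (free_lift (even_cycle_K n))"
proof -
  let ?G = "{{0, 2}, {0, 3}, {0, 4}, {0, 5}, {0, 6}, {0, 7}, {1, 2}, {2, 4}} :: nat set set"
  have "nine_edges - {{2, 6}} = ?G"
    by (simp add: nine_edges_def doubleton_eq_iff insert_Diff_if)
  moreover have "\<forall>e \<in> ?G. w e = 0" if "zero_sum ?G w" for w
  proof -
    have z: "(\<Sum>x \<in> ?G. if v \<in> x then w x else 0) = 0" for v
      using that by (simp only: zero_sum_iff finite.intros)
    \<comment> \<open>The equations at the leaves 1, 3, 5, 6, 7 remove all edges but the triangle 0,
      2, 4.\<close>
    show ?thesis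
      using z[of 0] z[of 1] z[of 2] z[of 3] z[of 4] z[of 5] z[of 6] z[of 7]
      by (simp add: doubleton_eq_iff)
  qed
  moreover have "nine_edges \<subseteq> edges (K n)" using assms by (simp add: nine_edges_def)
  moreover have "?G \<subseteq> edges (K n)" using assms by simp
  ultimately have "nine_edges - {{2, 6}} \<in> indep (even_cycle_K n)"
    by (simp only: even_cycle_matroid_def set_system.select_convs mem_Collect_eq) blast
  then show ?thesis using \<open>nine_edges \<subseteq> edges (K n)\<close>
    by (simp add: free_lift_def) metis
qed

section \<open>Rank bounds forced by the K_{2,3} circuits\<close>

text \<open>The first new edge \<open>{a0, b}\<close> raises the rank by at most one. Every further
  edge \<open>{a, b}\<close> completes a K_{2,3} with sides \<open>{a0, a}\<close> and
  \<open>{b, b1, b2}\<close>, so it is already spanned.\<close>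

lemma rank_le_bipartite_insert:
  assumes M: "matroid M"
    and circ: "\<forall>Y \<in> X_family n. \<forall>e \<in> Y. Y \<notin> indep M \<and> Y - {e} \<in> indep M"
    and le: "rank_le M (edges (complete_bipartite_graph A B)) k"
    and AB: "A \<noteq> {}" "A \<inter> B = {}" "A \<union> B \<subseteq> {..<n}" "b1 \<in> B" "b2 \<in> B" "b1 \<noteq> b2"
    and b: "b < n" "b \<notin> A \<union> B"
  shows "rank_le M (edges (complete_bipartite_graph A (insert b B))) (Suc k)"
proof -
  let ?E = "edges (complete_bipartite_graph A B)"
  obtain a0 where a0: "a0 \<in> A" using AB by blast
  have "rank_le M (?E \<union> (\<lambda>a. {a, b}) ` insert a0 A') (Suc k)" if "finite A'" "A' \<subseteq> A" for A'
    using that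
  proof (induction A')
    case empty
    show ?case using rank_le_insert[OF le M, of "{a0, b}"] by simp
  next
    case (insert a A')
    let ?S = "?E \<union> (\<lambda>a. {a, b}) ` insert a0 A'"
    have IH: "rank_le M ?S (Suc k)" using insert by simp
    have "rank_le M (insert {a, b} ?S) (Suc k)"
    proof (cases "a = a0")
      case True
      then show ?thesis using IH by (simp add: insert_absorb)
    next
      case False
      let ?Y = "k23_edges a0 a b b1 b2"
      have "distinct [a0, a, b, b1, b2]" "{a0, a, b, b1, b2} \<subseteq> {..<n}"
        using False a0 insert.prems AB b by auto
      then have "?Y \<in> X_family n" unfolding X_family_iff by blast
      then have Y: "?Y \<notin> indep M" "?Y - {{a, b}} \<in> indep M"
        using circ[rule_format, of ?Y "{a, b}"] by (simp_all add: k23_edges_def)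
      have "?Y - {{a, b}} \<subseteq> ?S"
        using a0 insert.prems AB by (auto simp: k23_edges_def)
      then show ?thesis using rank_le_insert_circuit[OF IH M Y] by blast
    qed
    moreover have "insert {a, b} ?S = ?E \<union> (\<lambda>a. {a, b}) ` insert a0 (insert a A')" by blast
    ultimately show ?case by simp
  qed
  from this[of A] have "rank_le M (?E \<union> (\<lambda>a. {a, b}) ` A) (Suc k)"
    using a0 AB finite_subset[of A "{..<n}"] by (simp add: insert_absorb)
  moreover have "edges (complete_bipartite_graph A (insert b B)) = ?E \<union> (\<lambda>a. {a, b}) ` A"
    by (auto simp: complete_bipartite_graph_def)
  ultimately show ?thesis by simp
qed

lemma complete_bipartite_graph_commute:
  "complete_bipartite_graph A B = complete_bipartite_graph B A"
  unfolding complete_bipartite_graph_def by (auto simp: insert_commute)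

text \<open>A 4-cycle has only four edges, and each of the four remaining vertices raises the rank
  by at most one.\<close>

lemma rank_le_K44:
  assumes M: "matroid M"
    and circ: "\<forall>Y \<in> X_family n. \<forall>e \<in> Y. Y \<notin> indep M \<and> Y - {e} \<in> indep M"
    and d: "distinct [a, b, c, d, p, q, r, s]" "{a, b, c, d, p, q, r, s} \<subseteq> {..<n}"
  shows "rank_le M (edges (complete_bipartite_graph {a, b, p, q} {c, d, r, s})) 8"
proof -
  note step = rank_le_bipartite_insert[OF M circ]
  let ?G = complete_bipartite_graph
  have "edges (?G {a, b} {c, d}) = {{a, c}, {a, d}, {b, c}, {b, d}}"
    by (auto simp: complete_bipartite_graph_def)
  moreover have "card I \<le> 4" if "I \<subseteq> {{a, c}, {a, d}, {b, c}, {b, d}}" for I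
    by (rule order_trans[OF card_mono[OF _ that]]) (simp_all add: card_insert_if)
  ultimately have "rank_le M (edges (?G {a, b} {c, d})) 4" by (simp add: rank_le_def)
  then have "rank_le M (edges (?G {a, b} {s, c, d})) 5"
    using step[of "{a, b}" "{c, d}" 4 c d s] d by auto
  then have "rank_le M (edges (?G {a, b} {r, s, c, d})) 6"
    using step[of "{a, b}" "{s, c, d}" 5 c d r] d by auto
  \<comment> \<open>The sides are exchanged here, because \<open>step\<close> enlarges the second
    one.\<close>
  then have "rank_le M (edges (?G {r, s, c, d} {q, a, b})) 7"
    using step[of "{r, s, c, d}" "{a, b}" 6 a b q] d
    by (auto simp: complete_bipartite_graph_commute[of "{a, b}"])
  then have "rank_le M (edges (?G {r, s, c, d} {p, q, a, b})) 8"
    using step[of "{r, s, c, d}" "{q, a, b}" 7 a b p] d by auto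
  moreover have "{r, s, c, d} = {c, d, r, s}" "{p, q, a, b} = {a, b, p, q}" by auto
  ultimately show ?thesis by (metis complete_bipartite_graph_commute)
qed

text \<open>The two 4-cycles span the copies of \<open>K\<^sub>4\<^sub>,\<^sub>4\<close> with sides \<open>{0,1,4,5}\<close>, \<open>{2,3,6,7}\<close> and
  \<open>{0,1,6,7}\<close>, \<open>{2,3,4,5}\<close>, whose union is not bipartite.\<close>

lemma no_common_elevation:
  assumes N: "matroid N" "truncate_to 6 N = U_matroid n" and n: "8 \<le> n"
    and D: "two_c4 \<in> indep N" and S: "nine_edges \<in> indep N"
  shows False
proof -
  have small: "F \<in> indep N \<longleftrightarrow> F \<subseteq> edges (K n) \<and> F \<notin> X_family n" if "card F \<le> 6" for F
    using arg_cong[OF N(2), of indep] that by (auto simp: truncate_to_def U_matroid_def set_eq_iff)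
  \<comment> \<open>Independence of sets of at most six edges is fixed by the truncation, and after
    the loss of an edge a member of \<open>X_family n\<close> is too small to be in the
    family.\<close>
  have circ: "\<forall>Y \<in> X_family n. \<forall>e \<in> Y. Y \<notin> indep N \<and> Y - {e} \<in> indep N"
  proof (intro ballI)
    fix Y e assume Y: "Y \<in> X_family n" and e: "e \<in> Y"
    have c: "card Y = 6" using card_X_family[OF Y] .
    then have c': "card (Y - {e}) = 5" using e by (simp add: card_Diff_singleton)
    then have "Y - {e} \<notin> X_family n" using card_X_family by fastforce
    then show "Y \<notin> indep N \<and> Y - {e} \<in> indep N"
      using small[of Y] small[of "Y - {e}"] c c' Y X_family_subset[OF Y] by auto
  qed
  let ?A = "edges (complete_bipartite_graph {0, 1, 4, 5} {2, 3, 6, 7}) :: nat set set"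
  let ?B = "edges (complete_bipartite_graph {0, 1, 6, 7} {2, 3, 4, 5}) :: nat set set"
  have "rank_le N ?A 8" "rank_le N ?B 8"
    using rank_le_K44[OF N(1) circ, of 0 1 2 3 4 5 6 7]
      rank_le_K44[OF N(1) circ, of 0 1 2 3 6 7 4 5] n by auto
  moreover have "two_c4 \<subseteq> ?A" "two_c4 \<subseteq> ?B" by (simp_all add: two_c4_def)
  ultimately have "rank_le N (?A \<union> ?B) 8"
    using rank_le_Un[OF N(1) D card_two_c4] by blast
  moreover have "nine_edges \<subseteq> ?A \<union> ?B" by (simp add: nine_edges_def)
  ultimately show False using S card_nine_edges by (fastforce simp: rank_le_def)
qed

section \<open>Two incompatible partial elevations\<close>

theorem theorem5p4:
  fixes n :: nat
  assumes "n \<ge> 36"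
  shows "matroid (U_matroid n) \<and>
    (\<exists>M1 M2. M1 \<noteq> M2 \<and>
       maximal_element weak_le (partial_elevations (U_matroid n)) M1 \<and>
       maximal_element weak_le (partial_elevations (U_matroid n)) M2)"
proof -
  have n: "8 \<le> n" using assms by simp
  let ?U = "U_matroid n" and ?P = "partial_elevations (U_matroid n)"
  let ?L = "free_lift (even_cycle_K n)"
  let ?R = "relaxation (truncate_to 8 ?L) two_c4"
  have L: "matroid ?L" by (simp add: matroid_free_lift matroid_even_cycle_K)
  \<comment> \<open>This makes the truncations to 6 and 8 have exactly these ranks.\<close>
  have rL: "9 \<le> rank ?L"
    using card_le_rank[OF L nine_edges_indep[OF n]] by (simp add: card_nine_edges)
  have U: "matroid ?U" and rU: "rank ?U = 6"
    using L rL by (simp_all add: U_matroid_eq_truncate matroid_truncate rank_truncate)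
  have gL: "ground ?L = edges (K n)" by (simp add: free_lift_def)
  have exch: "insert f (two_c4 - {e}) \<in> indep (truncate_to 8 ?L)"
    if "e \<in> two_c4" "f \<in> edges (K n) - two_c4" for e f
  proof -
    have "card (insert f (two_c4 - {e})) \<le> 8"
      using that(1) card_two_c4 card_insert_le_m1[of 8 "two_c4 - {e}" f]
      by (simp add: card_Diff_singleton)
    then show ?thesis using two_c4_exchange[OF that n] by (simp add: truncate_to_def)
  qed
  have T: "matroid (truncate_to 8 ?L)" using L by (rule matroid_truncate)
  have gT: "ground (truncate_to 8 ?L) = edges (K n)" by (simp add: truncate_to_def gL)
  \<comment> \<open>With one edge outside \<open>two_c4\<close> at hand, \<open>two_c4 - {e}\<close>
    is independent as part of an exchanged base.\<close>
  have f0: "{0, 1} \<in> edges (K n) - two_c4"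
    using n by (simp add: two_c4_def doubleton_eq_iff)
  have R: "matroid ?R"
  proof (rule matroid_relaxation[OF T])
    show "two_c4 \<subseteq> ground (truncate_to 8 ?L)" using two_c4_subset[OF n] unfolding gT .
    show "card two_c4 = rank (truncate_to 8 ?L)"
      using rL L by (simp add: card_two_c4 rank_truncate)
    show "insert f (two_c4 - {e}) \<in> indep (truncate_to 8 ?L)"
      if "e \<in> two_c4" "f \<in> ground (truncate_to 8 ?L) - two_c4" for e f
      using exch that unfolding gT by blast
    show "two_c4 - {e} \<in> indep (truncate_to 8 ?L)" if "e \<in> two_c4" for e
      by (rule matroid_hereditary[OF T exch[OF that f0]]) blast
  qed
  \<comment> \<open>The added base has eight elements, so the truncation to 6 does not see
    it.\<close>
  have "truncate_to 6 ?R = truncate_to 6 (truncate_to 8 ?L)"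
    using card_two_c4 by (auto simp: truncate_to_def relaxation_def)
  then have "truncate_to 6 ?R = ?U" by (simp add: truncate_truncate U_matroid_eq_truncate)
  then have RP: "?R \<in> ?P" using mem_partial_elevations_truncate[OF R, of 6] by simp
  have LP: "?L \<in> ?P"
    using mem_partial_elevations_truncate[OF L, of 6] by (simp add: U_matroid_eq_truncate)
  have P: "matroid N \<and> truncate_to 6 N = ?U" if "N \<in> ?P" for N
    using partial_elevations_truncate[OF U that] rU by simp
  obtain M1 where M1: "maximal_element weak_le ?P M1" "weak_le ?R M1"
    using ex_maximal_element_above[OF _ RP] P by blast
  obtain M2 where M2: "maximal_element weak_le ?P M2" "weak_le ?L M2"
    using ex_maximal_element_above[OF _ LP] P by blast
  have "M1 \<noteq> M2"
  proof
    assume "M1 = M2"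
    then have "two_c4 \<in> indep M1" "nine_edges \<in> indep M1"
      using M1(2) M2(2) nine_edges_indep[OF n] by (auto simp: weak_le_def relaxation_def)
    then show False using no_common_elevation P M1(1) n by (auto simp: maximal_element_def)
  qed
  then show ?thesis using U M1(1) M2(1) by blast
qed

end
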